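(* If $n=1$, then $r^{\pm}_{\mathcal{A},\mathcal{B}}(c) < \infty$ for all $c \in \mathbb{R}$. If $n=2$, then $r^{\pm}_{\mathcal{A},\mathcal{B}}(c) < \infty$ for all $c \in \mathbb{R}\setminus \{0\}$, but it is possible that $r^{\pm}_{\mathcal{A},\mathcal{B}}(0) = \infty$. Let $n \geq 3$, let $s \in \{2,3,\ldots, n-1\}$, let $J = (j_1,\ldots, j_s) \preceq (1,\ldots, n)$, and let $L = (1,\ldots, n) \setminus J$. If $r^{\pm}_{\mathcal{A}_J,\mathcal{B}_J}(0) = \infty$, then $r^{\pm}_{\mathcal{A},\mathcal{B}}(c) = \infty$ for all $c \in \mathcal{E}^{\pm}(\mathcal{A}_L,\mathcal{B}_L)$.
   Context: Let $\mathcal{A} = (A_1,\ldots, A_n)$ be a sequence of nonempty finite sets of positive real numbers, and let $\mathcal{B} = (B_1,\ldots, B_n)$ be a sequence of infinite discrete sets of positive real numbers (a set $B$ is discrete if $B\cap X$ is finite for every bounded set $X$). Let $\mathcal{E}^{\pm}(\mathcal{A},\mathcal{B}) = \{ \sum_{i=1}^n \varepsilon_i a_i/b_i : a_i \in A_i,\ b_i \in B_i,\ \varepsilon_i \in \{1,-1\} \}$ be the set of signed weighted real Egyptian numbers, and for $c \in \mathbb{R}$ let $r^{\pm}_{\mathcal{A},\mathcal{B}}(c)$ be the number of $3n$-tuples $(a_1,\ldots,a_n,b_1,\ldots,b_n,\varepsilon_1,\ldots,\varepsilon_n) \in A_1\times\cdots\times A_n\times B_1\times\cdots\times B_n\times\{1,-1\}^n$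 with $\sum_{i=1}^n \varepsilon_i a_i/b_i = c$. For integers $j_1,\ldots,j_s$, write $(j_1,\ldots,j_s) \preceq (1,\ldots,n)$ if $1 \le j_1 < \cdots < j_s \le n$; for such $J$, $L = (1,\ldots,n)\setminus J = (\ell_1,\ldots,\ell_{n-s})$ is the increasing tuple obtained by deleting $j_1,\ldots,j_s$, and $\mathcal{A}_J = (A_{j_1},\ldots,A_{j_s})$, $\mathcal{A}_L = (A_{\ell_1},\ldots,A_{\ell_{n-s}})$, and similarly $\mathcal{B}_J$, $\mathcal{B}_L$. *)

theory Defs
  imports "HOL-Analysis.Analysis" "HOL-Library.Extended_Nat"
begin

text \<open>Finite sequences are lists. Sequence positions are numbered from 1, so the entry at
  position \<open>j\<close> of a list \<open>xs\<close> is \<open>xs ! (j - 1)\<close>.\<close>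

text \<open>Finiteness of the traces on bounded sets; this is stronger than having the discrete
  subspace topology (the set of all \<open>1 / k\<close> is excluded).\<close>

definition discrete_set :: "real set \<Rightarrow> bool" where
  "discrete_set B \<longleftrightarrow> (\<forall>X. bounded X \<longrightarrow> finite (B \<inter> X))"

definition numerator_sets :: "nat \<Rightarrow> real set list \<Rightarrow> bool" where
  "numerator_sets n As \<longleftrightarrow>
     length As = n \<and> (\<forall>A \<in> set As. A \<noteq> {} \<and> finite A \<and> (\<forall>a \<in> A. 0 < a))"

definition denominator_sets :: "nat \<Rightarrow> real set list \<Rightarrow> bool" where
  "denominator_sets n Bs \<longleftrightarrow>
     length Bs = n \<and> (\<forall>B \<in> set Bs. infinite B \<and> discrete_set B \<and> (\<forall>b \<in> B. 0 < b))"

text \<open>The \<open>3n\<close>-tuples \<open>(a\<^sub>1, \<dots>, a\<^sub>n, b\<^sub>1, \<dots>, b\<^sub>n, \<epsilon>\<^sub>1, \<dots>, \<epsilon>\<^sub>n)\<close> are grouped into three lists of length \<open>n\<close>.\<close>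

definition signed_tuples ::
  "real set list \<Rightarrow> real set list \<Rightarrow> (real list \<times> real list \<times> real list) set" where
  "signed_tuples As Bs = listset As \<times> listset Bs \<times> listset (replicate (length As) {1, -1})"

definition signed_sum :: "real list \<times> real list \<times> real list \<Rightarrow> real" where
  "signed_sum = (\<lambda>(as, bs, es). \<Sum>i<length as. es ! i * (as ! i / bs ! i))"

definition signed_egyptian :: "real set list \<Rightarrow> real set list \<Rightarrow> real set" where
  "signed_egyptian As Bs = signed_sum ` signed_tuples As Bs"

definition signed_rep_count :: "real set list \<Rightarrow> real set list \<Rightarrow> real \<Rightarrow> enat" where
  "signed_rep_count As Bs c =
     (let S = {t \<in> signed_tuples As Bs. signed_sum t = c}
      in if finite S then enat (card S) else \<infinity>)"

definition increasing_indices :: "nat list \<Rightarrow> nat \<Rightarrow> bool" where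
  "increasing_indices J n \<longleftrightarrow> sorted_wrt (<) J \<and> set J \<subseteq> {1..n}"

definition complement_indices :: "nat \<Rightarrow> nat list \<Rightarrow> nat list" where
  "complement_indices n J = filter (\<lambda>i. i \<notin> set J) [1..<n + 1]"

definition subsequence_at :: "'a list \<Rightarrow> nat list \<Rightarrow> 'a list" where
  "subsequence_at xs J = map (\<lambda>j. xs ! (j - 1)) J"

end

theory Submission
  imports Defs
begin

text \<open>Discreteness leaves only finitely many fractions \<open>\<plusminus>a / b\<close> of absolute value at least \<open>d\<close>, for
  each \<open>d > 0\<close>; if two fractions sum to \<open>c \<noteq> 0\<close>, one of them has absolute value at least
  \<open>\<bar>c\<bar> / 2\<close>, and it determines the value of the other. For the last claim, a representation of \<open>0\<close>
  over \<open>J\<close> and a fixed representation of \<open>c\<close> over the complement interleave to a representation of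
  \<open>c\<close>, so every representation of \<open>0\<close> over \<open>J\<close> is the restriction of one of \<open>c\<close>.\<close>

section \<open>Membership in products and finiteness of counts\<close>

lemma listset_iff: "xs \<in> listset Xs \<longleftrightarrow> list_all2 (\<in>) xs Xs"
  by (induction Xs arbitrary: xs) (auto simp: set_Cons_def list_all2_Cons2)

lemma signed_rep_count_infinite_iff:
  "signed_rep_count As Bs c = \<infinity> \<longleftrightarrow> infinite {t \<in> signed_tuples As Bs. signed_sum t = c}"
  by (simp add: signed_rep_count_def Let_def)

lemma signed_rep_count_finite_iff:
  "signed_rep_count As Bs c < \<infinity> \<longleftrightarrow> finite {t \<in> signed_tuples As Bs. signed_sum t = c}"
  by (simp add: signed_rep_count_def Let_def)

section \<open>Finiteness for one and two terms\<close>

definition signed_fractions :: "real set \<Rightarrow> real set \<Rightarrow> (real \<times> real \<times> real) set" where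
  "signed_fractions A B = A \<times> B \<times> {1, -1}"

definition signed_fraction :: "real \<times> real \<times> real \<Rightarrow> real" where
  "signed_fraction = (\<lambda>(a, b, e). e * (a / b))"

text \<open>The inequality \<open>d \<le> a / b\<close> bounds \<open>b\<close> by
  \<open>a / d\<close>. Each of the finitely many \<open>a\<close> thus confines \<open>b\<close> to
  a bounded interval, which meets the discrete set \<open>B\<close> in finitely many points; the
  sign adds only a factor of two.\<close>

lemma finite_large_signed_fractions:
  assumes A: "finite A" "\<forall>a\<in>A. 0 < a" and B: "discrete_set B" "\<forall>b\<in>B. 0 < b" and "0 < d"
  shows "finite {p \<in> signed_fractions A B. d \<le> \<bar>signed_fraction p\<bar>}"
proof (rule finite_subset)
  let ?B = "\<Union>a\<in>A. B \<inter> {0..a / d}"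
  show "finite (A \<times> ?B \<times> {1, -1 :: real})"
    using A(1) B(1) by (simp add: discrete_set_def del: UN_simps)
  show "{p \<in> signed_fractions A B. d \<le> \<bar>signed_fraction p\<bar>} \<subseteq> A \<times> ?B \<times> {1, -1}"
  proof
    fix p assume "p \<in> {p \<in> signed_fractions A B. d \<le> \<bar>signed_fraction p\<bar>}"
    moreover obtain a b e where p: "p = (a, b, e)"
      by (cases p) auto
    ultimately have "(a, b, e) \<in> signed_fractions A B" and le: "d \<le> \<bar>signed_fraction (a, b, e)\<bar>"
      by auto
    then have abe: "a \<in> A" "b \<in> B" "e \<in> {1, -1}" and pos: "0 < a" "0 < b"
      using A(2) B(2) by (auto simp: signed_fractions_def)
    then have "d \<le> a / b"
      using le by (auto simp: signed_fraction_def)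
    then have "b \<le> a / d"
      using pos \<open>0 < d\<close> by (simp add: field_simps)
    then show "p \<in> A \<times> ?B \<times> {1, -1}"
      using abe pos by (auto simp: p)
  qed
qed

text \<open>For \<open>c \<noteq> 0\<close> all these fractions are large in the previous sense,
  with \<open>d = \<bar>c\<bar>\<close>. The value 0 is never attained, since numerators and
  denominators are positive.\<close>

lemma finite_signed_fractions_eq:
  assumes "finite A" "\<forall>a\<in>A. 0 < a" "discrete_set B" "\<forall>b\<in>B. 0 < b"
  shows "finite {p \<in> signed_fractions A B. signed_fraction p = c}"
proof (cases "c = 0")
  case True
  then have "{p \<in> signed_fractions A B. signed_fraction p = c} = {}"
    using assms by (fastforce simp: signed_fractions_def signed_fraction_def)
  then show ?thesis
    by (simp only: finite.emptyI)
next
  case False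
  then show ?thesis
    using finite_large_signed_fractions[OF assms, of "\<bar>c\<bar>"] by (auto elim: rev_finite_subset)
qed

lemma finite_representations_1:
  assumes "numerator_sets 1 As" "denominator_sets 1 Bs"
  shows "finite {t \<in> signed_tuples As Bs. signed_sum t = c}"
proof -
  obtain A B where AB: "As = [A]" "Bs = [B]"
    using assms by (auto simp: numerator_sets_def denominator_sets_def length_Suc_conv)
  \<comment> \<open>A one-term tuple is a triple with each component wrapped in a singleton list, so
    the count is that of a fibre of \<open>signed_fraction\<close>.\<close>
  have "{t \<in> signed_tuples As Bs. signed_sum t = c}
      \<subseteq> (\<lambda>(a, b, e). ([a], [b], [e])) ` {p \<in> signed_fractions A B. signed_fraction p = c}"
    by (auto simp: AB signed_tuples_def set_Cons_def signed_sum_def signed_fractions_def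
        signed_fraction_def image_iff)
  moreover have "finite {p \<in> signed_fractions A B. signed_fraction p = c}"
    using assms by (intro finite_signed_fractions_eq)
      (auto simp: AB numerator_sets_def denominator_sets_def)
  ultimately show ?thesis
    by (meson finite_imageI finite_subset)
qed

lemma finite_representations_2:
  assumes "numerator_sets 2 As" "denominator_sets 2 Bs" "c \<noteq> 0"
  shows "finite {t \<in> signed_tuples As Bs. signed_sum t = c}"
proof -
  obtain A A' B B' where AB: "As = [A, A']" "Bs = [B, B']"
    using assms
    by (auto simp: numerator_sets_def denominator_sets_def length_Suc_conv numeral_2_eq_2)
  have A: "finite A" "\<forall>a\<in>A. 0 < a" "finite A'" "\<forall>a\<in>A'. 0 < a"
    and B: "discrete_set B" "\<forall>b\<in>B. 0 < b" "discrete_set B'" "\<forall>b\<in>B'. 0 < b"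
    using assms by (auto simp: AB numerator_sets_def denominator_sets_def)
  define G where "G A B = {p \<in> signed_fractions A B. \<bar>c\<bar> / 2 \<le> \<bar>signed_fraction p\<bar>}" for A B
  define F where "F A B d = {p \<in> signed_fractions A B. signed_fraction p = d}" for A B d
  have finG: "finite (G A B)" "finite (G A' B')"
    unfolding G_def using A B \<open>c \<noteq> 0\<close> by (simp_all add: finite_large_signed_fractions
        del: le_divide_eq_numeral1 divide_le_eq_numeral1)
  have finF: "finite (F A B d)" "finite (F A' B' d)" for d
    unfolding F_def using A B by (auto intro!: finite_signed_fractions_eq)
  \<comment> \<open>Pairs whose first fraction is large, together with pairs whose second one is;
    the latter are listed with the large fraction first and then swapped. The remaining fraction
    lies in a fibre \<open>F\<close>, which is finite for every value, 0 included.\<close>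
  define P where "P = (SIGMA p : G A B. F A' B' (c - signed_fraction p))
    \<union> (\<lambda>(q, p). (p, q)) ` (SIGMA q : G A' B'. F A B (c - signed_fraction q))"
  have "finite P"
    using finG finF by (auto simp: P_def)
  moreover have "{t \<in> signed_tuples As Bs. signed_sum t = c}
    \<subseteq> (\<lambda>((a, b, e), (a', b', e')). ([a, a'], [b, b'], [e, e'])) ` P"
  proof
    fix t assume "t \<in> {t \<in> signed_tuples As Bs. signed_sum t = c}"
    then obtain a a' b b' e e' where t: "t = ([a, a'], [b, b'], [e, e'])"
      and p: "(a, b, e) \<in> signed_fractions A B" and q: "(a', b', e') \<in> signed_fractions A' B'"
      and c: "signed_fraction (a, b, e) + signed_fraction (a', b', e') = c"
      by (auto simp: AB signed_tuples_def set_Cons_def signed_sum_def signed_fractions_def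
          signed_fraction_def)
    have "\<bar>c\<bar> / 2 \<le> \<bar>signed_fraction (a, b, e)\<bar> \<or> \<bar>c\<bar> / 2 \<le> \<bar>signed_fraction (a', b', e')\<bar>"
      using c by linarith
    then have "((a, b, e), (a', b', e')) \<in> P"
      using p q c by (auto simp: P_def G_def F_def image_iff)
    then show "t \<in> (\<lambda>((a, b, e), (a', b', e')). ([a, a'], [b, b'], [e, e'])) ` P"
      using t by force
  qed
  ultimately show ?thesis
    by (meson finite_imageI finite_subset)
qed

section \<open>Infinitely many representations of zero\<close>

lemma infinite_representations_of_0:
  "\<exists>As Bs. numerator_sets 2 As \<and> denominator_sets 2 Bs \<and> signed_rep_count As Bs 0 = \<infinity>"
proof -
  define B :: "real set" where "B = real ` {1..}"
  have "discrete_set B"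
    unfolding discrete_set_def
  proof (intro allI impI)
    fix X :: "real set" assume "bounded X"
    then obtain M where M: "\<And>x. x \<in> X \<Longrightarrow> \<bar>x\<bar> \<le> M"
      by (auto simp: bounded_iff)
    \<comment> \<open>The elements of \<open>B\<close> are natural numbers, so a bound
      \<open>M\<close> on \<open>X\<close> leaves only those up to its ceiling.\<close>
    have "B \<inter> X \<subseteq> real ` {..nat \<lceil>M\<rceil>}"
    proof
      fix x assume "x \<in> B \<inter> X"
      then obtain k where "x = real k"
        by (auto simp: B_def)
      moreover have "\<bar>x\<bar> \<le> M"
        using M \<open>x \<in> B \<inter> X\<close> by blast
      ultimately have "k \<le> nat \<lceil>M\<rceil>"
        by linarith
      then show "x \<in> real ` {..nat \<lceil>M\<rceil>}"
        using \<open>x = real k\<close> by simp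
    qed
    then show "finite (B \<inter> X)"
      by (rule finite_subset) simp
  qed
  moreover have "infinite B"
    by (auto simp: B_def finite_image_iff inj_on_def infinite_Ici)
  ultimately have "denominator_sets 2 [B, B]"
    by (auto simp: denominator_sets_def B_def)
  moreover have "numerator_sets 2 [{1}, {1}]"
    by (simp add: numerator_sets_def)
  moreover have "signed_rep_count [{1}, {1}] [B, B] 0 = \<infinity>"
    unfolding signed_rep_count_infinite_iff
  proof
    let ?S = "{t \<in> signed_tuples [{1}, {1}] [B, B]. signed_sum t = 0}"
    assume "finite ?S"
    \<comment> \<open>The cancellation \<open>1 / b - 1 / b = 0\<close> gives one representation for
      each \<open>b\<close>, and distinct \<open>b\<close> give distinct tuples.\<close>
    moreover have "(\<lambda>b. ([1, 1], [b, b], [1, -1])) ` B \<subseteq> ?S"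
      by (auto simp: signed_tuples_def set_Cons_def signed_sum_def)
    ultimately have "finite ((\<lambda>b. ([1::real, 1::real], [b, b], [1::real, -1])) ` B)"
      by (rule rev_finite_subset)
    then show False
      using \<open>infinite B\<close> by (simp add: finite_image_iff inj_on_def)
  qed
  ultimately show ?thesis
    by blast
qed

section \<open>Rearranging positions\<close>

lemma length_subsequence_at [simp]: "length (subsequence_at xs J) = length J"
  by (simp add: subsequence_at_def)

lemma subsequence_at_append: "subsequence_at xs (J @ L) = subsequence_at xs J @ subsequence_at xs L"
  by (simp add: subsequence_at_def)

text \<open>Lets the list of sign sets be restricted to chosen positions in the same way as the
  lists of numerator and denominator sets.\<close>

lemma subsequence_at_replicate:
  assumes "set J \<subseteq> {1..n}"
  shows "subsequence_at (replicate n x) J = replicate (length J) x"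
proof (rule nth_equalityI)
  fix i assume "i < length (subsequence_at (replicate n x) J)"
  then have "J ! i \<in> {1..n}"
    using assms by (metis length_subsequence_at nth_mem subsetD)
  then show "subsequence_at (replicate n x) J ! i = replicate (length J) x ! i"
    using \<open>i < _\<close> by (auto simp: subsequence_at_def)
qed simp

text \<open>\<open>K\<close> is a permutation of the positions, later \<open>J\<close> followed by
  its complement. Since list indices start at 0 and entries of \<open>K\<close> at 1, the
  permutation of \<open>{..<n}\<close> behind it is \<open>k \<mapsto> K ! k - 1\<close>.\<close>

locale enumeration =
  fixes n :: nat and K :: "nat list"
  assumes distinct: "distinct K" and set_eq: "set K = {1..n}"
begin

lemma length_eq: "length K = n"
  using distinct_card[OF distinct] set_eq by simp

lemma bij_betw_nth_pred: "bij_betw (\<lambda>k. K ! k - 1) {..<n} {..<n}"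
proof -
  have "bij_betw ((!) K) {..<n} {1..n}"
    using bij_betw_nth[OF distinct] set_eq length_eq by simp
  moreover have "bij_betw (\<lambda>j. j - 1) {1..n} {..<n}"
    by (rule bij_betw_byWitness[where f' = Suc]) auto
  ultimately have "bij_betw ((\<lambda>j. j - 1) \<circ> (!) K) {..<n} {..<n}"
    by (rule bij_betw_trans)
  then show ?thesis
    by (simp add: comp_def)
qed

lemma nth_less: "k < n \<Longrightarrow> K ! k - 1 < n"
  using bij_betw_nth_pred by (auto dest: bij_betwE)

lemma obtain_subsequence_at_eq:
  assumes "length z = n"
  obtains x where "length x = n" "subsequence_at x K = z"
proof
  \<comment> \<open>The inverse permutation puts each entry of \<open>z\<close> back at its original
    position.\<close>
  let ?x = "map (\<lambda>i. z ! (inv_into {..<n} (\<lambda>k. K ! k - 1) i)) [0..<n]"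
  show "length ?x = n" by simp
  have "inv_into {..<n} (\<lambda>k. K ! k - 1) (K ! k - 1) = k" if "k < n" for k
    using inv_into_f_f[OF bij_betw_imp_inj_on[OF bij_betw_nth_pred]] that by simp
  then show "subsequence_at ?x K = z"
    using assms nth_less by (intro nth_equalityI) (auto simp: subsequence_at_def length_eq)
qed

lemma listset_subsequence_at_iff:
  assumes "length x = n" "length Xs = n"
  shows "subsequence_at x K \<in> listset (subsequence_at Xs K) \<longleftrightarrow> x \<in> listset Xs"
proof -
  \<comment> \<open>Membership is a condition on each position separately, and the bijection only
    renames the positions.\<close>
  have "(\<forall>i\<in>{..<n}. x ! i \<in> Xs ! i) \<longleftrightarrow> (\<forall>k\<in>{..<n}. x ! (K ! k - 1) \<in> Xs ! (K ! k - 1))"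
    by (subst bij_betw_imp_surj_on[OF bij_betw_nth_pred, symmetric]) simp
  then show ?thesis
    using assms by (simp add: listset_iff list_all2_conv_all_nth subsequence_at_def length_eq Ball_def)
qed

lemma signed_sum_subsequence_at:
  assumes "length as = n"
  shows "signed_sum (subsequence_at as K, subsequence_at bs K, subsequence_at es K)
    = signed_sum (as, bs, es)"
  using sum.reindex_bij_betw[OF bij_betw_nth_pred, of "\<lambda>i. es ! i * (as ! i / bs ! i)"] assms
  by (simp add: signed_sum_def subsequence_at_def length_eq)

end

section \<open>Extending representations of zero\<close>

lemma enumeration_complement_indices:
  assumes "increasing_indices J n"
  shows "enumeration n (J @ complement_indices n J)"
  using assms
  by unfold_locales (auto simp: increasing_indices_def complement_indices_def strict_sorted_iff)

text \<open>The equal lengths align the three lists, so that the sum splits at the same index in all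
  of them.\<close>

lemma signed_sum_append:
  assumes "length bs = length as" "length es = length as"
  shows "signed_sum (as @ as', bs @ bs', es @ es')
    = signed_sum (as, bs, es) + signed_sum (as', bs', es')"
proof -
  have "(\<Sum>i<length as + m. f i) = (\<Sum>i<length as. f i) + (\<Sum>i<m. f (length as + i))"
    for m and f :: "nat \<Rightarrow> real"
    by (induction m) (simp_all add: add.assoc)
  then show ?thesis
    using assms by (simp add: signed_sum_def nth_append)
qed

lemma infinite_representations_extend:
  assumes "length As = n" "length Bs = n" "increasing_indices J n"
    and inf: "signed_rep_count (subsequence_at As J) (subsequence_at Bs J) 0 = \<infinity>"
    and c: "c \<in> signed_egyptian (subsequence_at As (complement_indices n J))
                                (subsequence_at Bs (complement_indices n J))"
  shows "signed_rep_count As Bs c = \<infinity>"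
proof -
  define L where "L = complement_indices n J"
  interpret enumeration n "J @ L"
    unfolding L_def using assms(3) by (rule enumeration_complement_indices)
  have J: "set J \<subseteq> {1..n}" and L: "set L \<subseteq> {1..n}"
    using set_eq by auto
  obtain as' bs' es' where t': "(as', bs', es') \<in> signed_tuples (subsequence_at As L) (subsequence_at Bs L)"
    and c_eq: "signed_sum (as', bs', es') = c"
    using c by (auto simp: signed_egyptian_def L_def)
  let ?T = "{t \<in> signed_tuples (subsequence_at As J) (subsequence_at Bs J). signed_sum t = 0}"
  let ?S = "{t \<in> signed_tuples As Bs. signed_sum t = c}"
  let ?restrict = "\<lambda>(as, bs, es). (subsequence_at as J, subsequence_at bs J, subsequence_at es J)"
  \<comment> \<open>The interleaving: \<open>x @ y\<close> is a choice along the enumeration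
    \<open>J @ L\<close>, and undoing the rearrangement yields \<open>z\<close>. It is applied in
    turn to numerators, denominators and signs.\<close>
  have extend: "\<exists>z. length z = n \<and> z \<in> listset Xs \<and> subsequence_at z J = x \<and> subsequence_at z L = y"
    if x: "x \<in> listset (subsequence_at Xs J)" and y: "y \<in> listset (subsequence_at Xs L)"
      and Xs: "length Xs = n" for x y and Xs :: "real set list"
  proof -
    have len: "length x = length J" "length y = length L"
      using x y by (auto simp: listset_iff dest: list_all2_lengthD)
    then have "length (x @ y) = n"
      using length_eq by simp
    then obtain z where z: "length z = n" "subsequence_at z (J @ L) = x @ y"
      by (rule obtain_subsequence_at_eq)
    have "x @ y \<in> listset (subsequence_at Xs (J @ L))"
      using x y by (auto simp: listset_iff subsequence_at_append intro: list_all2_appendI)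
    then have "z \<in> listset Xs"
      using z Xs listset_subsequence_at_iff by metis
    then show ?thesis
      using z len by (auto simp: subsequence_at_append)
  qed
  \<comment> \<open>Restriction to \<open>J\<close> covers the infinite set \<open>?T\<close>, and a
    finite \<open>?S\<close> would have a finite image.\<close>
  have "?T \<subseteq> ?restrict ` ?S"
  proof
    fix t assume "t \<in> ?T"
    then obtain as bs es where t: "t = (as, bs, es)"
      "(as, bs, es) \<in> signed_tuples (subsequence_at As J) (subsequence_at Bs J)"
      "signed_sum (as, bs, es) = 0"
      by (cases t) auto
    let ?Es = "replicate n {1, -1 :: real}"
    obtain u where u: "length u = n" "u \<in> listset As" "subsequence_at u J = as" "subsequence_at u L = as'"
      using extend[of as As as'] t t' assms by (auto simp: signed_tuples_def)
    obtain v where v: "v \<in> listset Bs" "subsequence_at v J = bs" "subsequence_at v L = bs'"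
      using extend[of bs Bs bs'] t t' assms by (auto simp: signed_tuples_def)
    obtain w where w: "w \<in> listset ?Es" "subsequence_at w J = es" "subsequence_at w L = es'"
      using extend[of es ?Es es'] t t' J L
      by (auto simp: signed_tuples_def subsequence_at_replicate)
    \<comment> \<open>Reordering the terms along \<open>J @ L\<close> separates the part over
      \<open>J\<close>, which is 0, from the fixed part over \<open>L\<close>, which is
      \<open>c\<close>.\<close>
    have "signed_sum (u, v, w) = signed_sum (as @ as', bs @ bs', es @ es')"
      using signed_sum_subsequence_at[OF u(1), of v w] u v w by (simp add: subsequence_at_append)
    also have "\<dots> = signed_sum (as, bs, es) + signed_sum (as', bs', es')"
      using u v w by (intro signed_sum_append) auto
    finally have "signed_sum (u, v, w) = c"
      using t c_eq by simp
    then have "(u, v, w) \<in> ?S"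
      using u v w assms by (simp add: signed_tuples_def)
    then show "t \<in> ?restrict ` ?S"
      using t u v w by (force intro: rev_image_eqI)
  qed
  then show ?thesis
    using inf unfolding signed_rep_count_infinite_iff by (meson finite_imageI finite_subset)
qed

theorem theorem2:
  shows "(\<forall>As Bs. numerator_sets 1 As \<and> denominator_sets 1 Bs \<longrightarrow>
            (\<forall>c. signed_rep_count As Bs c < \<infinity>))
       \<and> (\<forall>As Bs. numerator_sets 2 As \<and> denominator_sets 2 Bs \<longrightarrow>
            (\<forall>c. c \<noteq> 0 \<longrightarrow> signed_rep_count As Bs c < \<infinity>))
       \<and> (\<exists>As Bs. numerator_sets 2 As \<and> denominator_sets 2 Bs \<and>
            signed_rep_count As Bs 0 = \<infinity>)
       \<and> (\<forall>n As Bs s J. n \<ge> 3 \<and> numerator_sets n As \<and> denominator_sets n Bs \<and>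
            s \<in> {2..n - 1} \<and> length J = s \<and> increasing_indices J n \<and>
            signed_rep_count (subsequence_at As J) (subsequence_at Bs J) 0 = \<infinity> \<longrightarrow>
            (\<forall>c \<in> signed_egyptian (subsequence_at As (complement_indices n J))
                                   (subsequence_at Bs (complement_indices n J)).
               signed_rep_count As Bs c = \<infinity>))"
  apply (intro conjI allI impI ballI)
     apply (simp only: signed_rep_count_finite_iff finite_representations_1)
    apply (simp only: signed_rep_count_finite_iff finite_representations_2 not_False_eq_True)
   apply (rule infinite_representations_of_0)
  apply (elim conjE)
  apply (rule infinite_representations_extend)
      apply (simp_all add: numerator_sets_def denominator_sets_def)
  done

end
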